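(* Let $G$ be a finite group of order $2n$ with $n\geq 2$, and let $S$ be a generating set of $G$ (with $e\notin S$) such that the undirected Cayley graph $\Gamma(G,S)$ is a complete bipartite graph. Then Player 2 has a winning strategy for $\texttt{REL}(G,S)$ and Player 1 has a winning strategy for $\texttt{RAV}(G,S)$.
   Context: Games $\texttt{REL}(G,S)$ and $\texttt{RAV}(G,S)$: $G$ is a finite group and $S$ a generating set with $e\notin S$. Two players alternate turns, Player 1 first, starting from the empty word $w_0$. On turn $n$ the current player chooses $s_n\in S\cup S^{-1}$, subject to $s_n\neq s_{n-1}^{-1}$ when $n>1$, and forms $w_n=w_{n-1}s_n$. If $w_n$ represents the same element of $G$ as some $w_k$ with $0\le k<n$, the game ends: the player who formed $w_n$ wins $\texttt{REL}(G,S)$ and loses $\texttt{RAV}(G,S)$. If a player has no legal move, that player loses. The undirected Cayley graph $\Gamma(G,S)$ has vertex set $G$, with $g$ and $h$ adjacent whenever $h=gs$ for some $s\in S$; playing the games amounts to walking in $\Gamma(G,S)$ from $e$ without backtracking. *)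

theory Defs
  imports
    "HOL-Algebra.Coset"
    "HOL-Algebra.Generated_Groups"
    "Graph_Theory.Pair_Digraph"
    "Graph_Theory.Kuratowski"
begin

text \<open>
  Undirected graphs are represented as symmetric digraphs, as in \<^theory>\<open>Graph_Theory.Kuratowski\<close>.
  The result is a simple graph: several generators relating the same two vertices yield one edge.
\<close>

definition cayley_graph :: "('a, 'b) monoid_scheme \<Rightarrow> 'a set \<Rightarrow> 'a pair_pre_digraph" where
  "cayley_graph G S =
    \<lparr>pverts = carrier G,
     parcs = {(g, h). g \<in> carrier G \<and> h \<in> carrier G \<and>
                (\<exists>s\<in>S. h = g \<otimes>\<^bsub>G\<^esub> s \<or> g = h \<otimes>\<^bsub>G\<^esub> s)}\<rparr>"

text \<open>
  A position of the game is the list \<open>[s\<^sub>1, \<dots>, s\<^sub>n]\<close> of the moves made so far, so it carries the whole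
  history, and the word \<open>w\<^sub>k\<close> is its prefix of length \<open>k\<close>.
\<close>

definition word_value :: "('a, 'b) monoid_scheme \<Rightarrow> 'a list \<Rightarrow> 'a" where
  "word_value G w = foldl (\<lambda>x s. x \<otimes>\<^bsub>G\<^esub> s) \<one>\<^bsub>G\<^esub> w"

definition repeats :: "('a, 'b) monoid_scheme \<Rightarrow> 'a list \<Rightarrow> bool" where
  "repeats G w \<longleftrightarrow> (\<exists>k < length w. word_value G w = word_value G (take k w))"

definition legal_move :: "('a, 'b) monoid_scheme \<Rightarrow> 'a set \<Rightarrow> 'a list \<Rightarrow> 'a \<Rightarrow> bool" where
  "legal_move G S w s \<longleftrightarrow>
     s \<in> S \<union> set_inv\<^bsub>G\<^esub> S \<and> (w \<noteq> [] \<longrightarrow> s \<noteq> inv\<^bsub>G\<^esub> (last w))"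

definition game_over :: "('a, 'b) monoid_scheme \<Rightarrow> 'a set \<Rightarrow> 'a list \<Rightarrow> bool" where
  "game_over G S w \<longleftrightarrow> repeats G w \<or> \<not> (\<exists>s. legal_move G S w s)"

datatype player = Player1 | Player2

fun opponent :: "player \<Rightarrow> player" where
  "opponent Player1 = Player2"
| "opponent Player2 = Player1"

definition to_move :: "'a list \<Rightarrow> player" where
  "to_move w = (if even (length w) then Player1 else Player2)"

datatype game = REL | RAV

text \<open>
  The winner at a position where the game is over.  If the last word repeats an earlier one, it was
  formed by the opponent of the player to move; otherwise the player to move is stuck and loses.
\<close>

fun winner :: "game \<Rightarrow> ('a, 'b) monoid_scheme \<Rightarrow> 'a list \<Rightarrow> player" where
  "winner REL G w = opponent (to_move w)"
| "winner RAV G w = (if repeats G w then to_move w else opponent (to_move w))"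

text \<open>The positions that can arise when player \<open>p\<close> follows \<open>\<sigma>\<close> and the opponent plays arbitrarily.\<close>

inductive consistent ::
  "('a, 'b) monoid_scheme \<Rightarrow> 'a set \<Rightarrow> player \<Rightarrow> ('a list \<Rightarrow> 'a) \<Rightarrow> 'a list \<Rightarrow> bool"
  for G S p \<sigma> where
  start: "consistent G S p \<sigma> []"
| move: "consistent G S p \<sigma> w \<Longrightarrow> \<not> game_over G S w \<Longrightarrow> legal_move G S w s \<Longrightarrow>
    (to_move w = p \<Longrightarrow> s = \<sigma> w) \<Longrightarrow> consistent G S p \<sigma> (w @ [s])"

text \<open>
  A winning strategy always prescribes a legal move, wins every finished play, and admits no
  infinite play.
\<close>

definition winning_strategy ::
  "game \<Rightarrow> ('a, 'b) monoid_scheme \<Rightarrow> 'a set \<Rightarrow> player \<Rightarrow> ('a list \<Rightarrow> 'a) \<Rightarrow> bool" where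
  "winning_strategy \<G> G S p \<sigma> \<longleftrightarrow>
     (\<forall>w. consistent G S p \<sigma> w \<longrightarrow>
        (if game_over G S w then winner \<G> G w = p
         else to_move w = p \<longrightarrow> legal_move G S w (\<sigma> w))) \<and>
     \<not> (\<exists>f :: nat \<Rightarrow> 'a. \<forall>n. consistent G S p \<sigma> (map f [0..<n]))"

definition has_winning_strategy ::
  "game \<Rightarrow> ('a, 'b) monoid_scheme \<Rightarrow> 'a set \<Rightarrow> player \<Rightarrow> bool" where
  "has_winning_strategy \<G> G S p \<longleftrightarrow> (\<exists>\<sigma>. winning_strategy \<G> G S p \<sigma>)"

end

theory Submission
  imports Defs
begin

text \<open>
  The neighbours of \<open>\<one>\<close> are exactly the legal first moves \<open>T = S \<union> S\<^sup>-\<^sup>1\<close>, so completeness makes \<open>T\<close> one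
  side of the bipartition; translation by an element of \<open>T\<close> swaps the sides, so both have \<open>n\<close>
  elements.  A walk is in \<open>T\<close> exactly at odd times.

  In \<open>REL\<close>, nobody can close a cycle before the fourth move, and from the third vertex, which lies
  in \<open>T\<close>, Player 2 can always return to \<open>\<one>\<close>.  In \<open>RAV\<close>, whenever Player 1 is to move, the
  self-avoiding walk has visited one vertex fewer in \<open>T\<close> than outside, so an unvisited neighbour
  remains; thus only Player 2 can be forced to repeat.
\<close>

section \<open>Words and plays\<close>

lemma word_value_Nil [simp]: "word_value G [] = \<one>\<^bsub>G\<^esub>"
  by (simp add: word_value_def)

lemma word_value_snoc [simp]: "word_value G (w @ [s]) = word_value G w \<otimes>\<^bsub>G\<^esub> s"
  by (simp add: word_value_def)

lemma consistent_prefix: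
  assumes "consistent G S p \<sigma> w" and "k < length w"
  shows "consistent G S p \<sigma> (take k w) \<and> \<not> game_over G S (take k w) \<and>
    legal_move G S (take k w) (w ! k) \<and> (to_move (take k w) = p \<longrightarrow> w ! k = \<sigma> (take k w))"
  using assms
proof (induction arbitrary: k)
  case start
  then show ?case by simp
next
  case (move w s)
  show ?case
  proof (cases "k < length w")
    case True
    with move.IH[OF True] show ?thesis by (simp add: nth_append)
  next
    case False
    with move.prems have "k = length w" by simp
    with move.hyps show ?thesis by (simp add: nth_append)
  qed
qed

text \<open>\<open>repeats\<close> tests only the final vertex, so it must fail at every prefix
  before the pigeonhole counts below can treat the visited vertices as distinct.\<close>

lemma inj_on_word_value_prefixes:
  assumes "\<And>k. k \<le> length w \<Longrightarrow> \<not> repeats G (take k w)"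
  shows "inj_on (\<lambda>k. word_value G (take k w)) {..length w}"
proof (rule linorder_inj_onI)
  fix i j
  assume "i < j" and "i \<in> {..length w}" and "j \<in> {..length w}"
  with assms[of j] show "word_value G (take i w) \<noteq> word_value G (take j w)"
    by (auto simp: repeats_def min_absorb1 min_absorb2)
qed auto

locale bipartite_cayley = group G for G (structure) +
  fixes S :: "'a set"
  assumes S_closed: "S \<subseteq> carrier G"
    and finite_carrier: "finite (carrier G)"
    and bipartite: "\<And>g h. \<lbrakk>g \<in> carrier G; h \<in> carrier G\<rbrakk> \<Longrightarrow>
      inv g \<otimes> h \<in> S \<union> set_inv S \<longleftrightarrow> (g \<in> S \<union> set_inv S \<longleftrightarrow> h \<notin> S \<union> set_inv S)"
begin

section \<open>The two sides of the bipartition\<close>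

definition T :: "'a set" where "T = S \<union> set_inv S"

lemma T_closed: "T \<subseteq> carrier G"
  using S_closed by (auto simp: T_def SET_INV_def)

lemma finite_T: "finite T"
  using T_closed finite_carrier by (rule finite_subset)

lemma inv_mult_in_T:
  "g \<in> carrier G \<Longrightarrow> h \<in> carrier G \<Longrightarrow> inv g \<otimes> h \<in> T \<longleftrightarrow> (g \<in> T \<longleftrightarrow> h \<notin> T)"
  using bipartite by (simp add: T_def)

lemma one_notin_T: "\<one> \<notin> T"
  using inv_mult_in_T[of \<one> \<one>] by simp

lemma inv_in_T: "t \<in> T \<Longrightarrow> inv t \<in> T"
  using inv_mult_in_T[of t \<one>] one_notin_T T_closed by auto

lemma mult_in_T: "g \<in> carrier G \<Longrightarrow> t \<in> T \<Longrightarrow> g \<otimes> t \<in> T \<longleftrightarrow> g \<notin> T"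
  using inv_mult_in_T[of g "g \<otimes> t"] T_closed by (auto simp: m_assoc[symmetric])

lemma card_complement_T:
  assumes "x \<in> T"
  shows "card (carrier G - T) = card T"
proof -
  have x: "x \<in> carrier G" using assms T_closed by auto
  have "(\<lambda>t. x \<otimes> t) ` T = carrier G - T"
  proof (intro equalityI subsetI)
    fix y assume y: "y \<in> carrier G - T"
    then have "inv x \<otimes> y \<in> T" using inv_mult_in_T[of x y] x assms by auto
    moreover have "y = x \<otimes> (inv x \<otimes> y)" using x y by (simp add: m_assoc[symmetric])
    ultimately show "y \<in> (\<lambda>t. x \<otimes> t) ` T" by blast
  qed (use assms x mult_in_T T_closed in auto)
  moreover have "inj_on (\<lambda>t. x \<otimes> t) T"
    using x T_closed by (auto intro!: inj_onI simp: subset_eq)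
  ultimately show ?thesis by (metis card_image)
qed

lemma word_value_closed: "set w \<subseteq> T \<Longrightarrow> word_value G w \<in> carrier G"
  by (induction w rule: rev_induct) (use T_closed in auto)

lemma word_value_in_T: "set w \<subseteq> T \<Longrightarrow> word_value G w \<in> T \<longleftrightarrow> odd (length w)"
  by (induction w rule: rev_induct) (auto simp: one_notin_T mult_in_T word_value_closed)

lemma prefix_value_closed: "set w \<subseteq> T \<Longrightarrow> word_value G (take k w) \<in> carrier G"
  by (meson order_trans set_take_subset word_value_closed)

lemma prefix_value_in_T:
  "set w \<subseteq> T \<Longrightarrow> k \<le> length w \<Longrightarrow> word_value G (take k w) \<in> T \<longleftrightarrow> odd k"
  by (subst word_value_in_T) (auto dest: in_set_takeD simp: min_def)

section \<open>Legal moves, short cycles and termination\<close>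

lemma legal_move_T: "legal_move G S w s \<longleftrightarrow> s \<in> T \<and> (w \<noteq> [] \<longrightarrow> s \<noteq> inv (last w))"
  by (simp add: legal_move_def T_def)

text \<open>Cancelling the value of \<open>u\<close>, where \<open>w = u @ [a]\<close>, leaves
  \<open>a \<otimes> s = \<one>\<close>. The ban on backtracking becomes a condition on vertices: do
  not return to the previous one.\<close>

lemma backtrack_iff:
  assumes "set w \<subseteq> T" and "w \<noteq> []" and "s \<in> T"
  shows "s = inv (last w) \<longleftrightarrow> word_value G (w @ [s]) = word_value G (take (length w - 1) w)"
proof -
  obtain u a where w: "w = u @ [a]" using assms(2) by (metis rev_exhaust)
  have c: "word_value G u \<in> carrier G" "a \<in> carrier G" "s \<in> carrier G"
    using assms word_value_closed[of u] T_closed by (auto simp: w)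
  have "word_value G u \<otimes> a \<otimes> s = word_value G u \<longleftrightarrow> a \<otimes> s = \<one>"
    using c by (simp add: m_assoc)
  also have "\<dots> \<longleftrightarrow> s = inv a"
    using c by (metis inv_equality inv_inv r_inv)
  finally show ?thesis
    using word_value_snoc[of G w s] by (simp add: w)
qed

text \<open>Parity and the ban on backtracking leave no cycle shorter than four.\<close>

lemma repeats_snoc_length:
  assumes "set w \<subseteq> T" and "legal_move G S w s" and "repeats G (w @ [s])"
  shows "3 \<le> length w"
proof -
  have s: "s \<in> T" using assms(2) by (simp add: legal_move_T)
  obtain k where k: "k \<le> length w" "word_value G (w @ [s]) = word_value G (take k w)"
    using assms(3) by (auto simp: repeats_def less_Suc_eq_le)
  have "odd k \<longleftrightarrow> odd (Suc (length w))"
    using prefix_value_in_T[OF assms(1) k(1)] word_value_in_T[of "w @ [s]"] k(2) assms(1) s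
    by simp
  moreover have "k \<noteq> length w - 1" if "0 < length w"
    using backtrack_iff[OF assms(1) _ s] k(2) assms(2) that by (auto simp: legal_move_T)
  \<comment> \<open>Parity rules out the distances \<open>0\<close> and \<open>2\<close> between
    \<open>k\<close> and \<open>length w\<close>, and the ban on backtracking rules out
    \<open>1\<close>.\<close>
  ultimately show ?thesis
    using k(1) by presburger
qed

lemma consistent_in_T:
  assumes "consistent G S p \<sigma> w"
  shows "set w \<subseteq> T"
  using assms by induction (auto simp: legal_move_T)

text \<open>Pigeonhole: every position of an infinite play is a proper prefix of the next, hence
  free of repetitions, but a word of length \<open>N\<close> passes through \<open>N + 1\<close>
  vertices.\<close>

lemma no_infinite_play: "\<not> (\<forall>n. consistent G S p \<sigma> (map f [0..<n]))"
proof
  assume all: "\<forall>n. consistent G S p \<sigma> (map f [0..<n])"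
  have norep: "\<not> repeats G (map f [0..<n])" for n
    using consistent_prefix[OF all[rule_format, of "Suc n"], of n]
    by (simp add: game_over_def)
  define N where "N = card (carrier G)"
  let ?w = "map f [0..<N]"
  have "\<not> repeats G (take k ?w)" if "k \<le> length ?w" for k
    using norep[of k] that by (simp add: take_map)
  then have "inj_on (\<lambda>k. word_value G (take k ?w)) {..length ?w}"
    by (rule inj_on_word_value_prefixes)
  moreover have "(\<lambda>k. word_value G (take k ?w)) ` {..length ?w} \<subseteq> carrier G"
    using prefix_value_closed[OF consistent_in_T] all by blast
  ultimately have "card {..length ?w} \<le> card (carrier G)"
    using finite_carrier by (rule card_inj_on_le)
  then show False by (simp add: N_def)
qed

lemma winning_strategyI:
  assumes "\<And>w. consistent G S p \<sigma> w \<Longrightarrow> game_over G S w \<Longrightarrow> winner \<G> G w = p"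
    and "\<And>w. consistent G S p \<sigma> w \<Longrightarrow> \<not> game_over G S w \<Longrightarrow> to_move w = p \<Longrightarrow>
      legal_move G S w (\<sigma> w)"
  shows "has_winning_strategy \<G> G S p"
  unfolding has_winning_strategy_def winning_strategy_def
  using assms no_infinite_play by auto

section \<open>The game \<open>REL\<close>\<close>

theorem REL_Player2:
  assumes "2 \<le> card T"
  shows "has_winning_strategy REL G S Player2"
proof -
  \<comment> \<open>Player 2 will move only at lengths one and three: first any legal letter, then
    the letter leading back to \<open>\<one>\<close>.\<close>
  define \<sigma> where
    "\<sigma> w = (if length w = 1 then SOME s. legal_move G S w s else inv (word_value G w))" for w
  \<comment> \<open>The fourth letter repeats the empty prefix, so a position of length four cannot
    be extended.\<close>
  have len: "length w \<le> 4" if w: "consistent G S Player2 \<sigma> w" for w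
  proof (rule ccontr)
    assume "\<not> length w \<le> 4"
    then have long: "4 < length w" by simp
    have "take 4 w = take 3 w @ [w ! 3]"
      using long take_Suc_conv_app_nth[of 3 w] by simp
    moreover have "w ! 3 = inv (word_value G (take 3 w))"
      using consistent_prefix[OF w, of 3] long by (simp add: to_move_def \<sigma>_def)
    ultimately have "word_value G (take 4 w) = \<one>"
      using prefix_value_closed[OF consistent_in_T[OF w]] by simp
    then have "repeats G (take 4 w)"
      using long by (auto simp: repeats_def intro!: exI[of _ 0])
    then show False
      using consistent_prefix[OF w long] by (simp add: game_over_def)
  qed
  \<comment> \<open>Lengths one and three are too short for a cycle, so no consistent play ends with
    Player 2 to move.\<close>
  have odd_turn: "\<not> repeats G w \<and> legal_move G S w (\<sigma> w)"
    if w: "consistent G S Player2 \<sigma> w" and odd: "odd (length w)" for w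
  proof -
    obtain u s where us: "w = u @ [s]" using odd by (cases w rule: rev_cases) auto
    have wT: "set w \<subseteq> T" using consistent_in_T[OF w] .
    have s: "legal_move G S u s" "\<not> repeats G u"
      using consistent_prefix[OF w, of "length u"] by (auto simp: us game_over_def)
    have lw: "length w = 1 \<or> length w = 3"
    proof -
      have "length w < 5" using len[OF w] by simp
      with odd show ?thesis by presburger
    qed
    have "\<not> repeats G w"
      using repeats_snoc_length[of u s] s wT lw by (auto simp: us)
    moreover have "legal_move G S w (\<sigma> w)"
    proof (cases "length w = 1")
      case True
      \<comment> \<open>Only one letter is forbidden after the first move;
        \<open>2 \<le> card T\<close> leaves another.\<close>
      have "\<not> T \<subseteq> {inv (last w)}"
      proof
        assume "T \<subseteq> {inv (last w)}"
        then have "card T \<le> card {inv (last w)}" by (intro card_mono) auto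
        with assms show False by simp
      qed
      then have "\<exists>s. legal_move G S w s" by (auto simp: legal_move_T)
      then show ?thesis using True by (auto simp: \<sigma>_def intro: someI_ex)
    next
      case False
      then have l3: "length w = 3" using lw by simp
      have \<sigma>w: "\<sigma> w = inv (word_value G w)" using False by (simp add: \<sigma>_def)
      have inT: "\<sigma> w \<in> T"
        using word_value_in_T[OF wT] odd by (simp add: \<sigma>w inv_in_T)
      have "word_value G (w @ [\<sigma> w]) = \<one>"
        using word_value_closed[OF wT] by (simp add: \<sigma>w)
      \<comment> \<open>The vertex before the current one is not \<open>\<one>\<close>, since
        \<open>u\<close> has no repetition; so returning to \<open>\<one>\<close> is not
        backtracking.\<close>
      moreover have "word_value G u \<noteq> \<one>"
        using s(2) l3 by (auto simp: repeats_def us dest!: spec[of _ 0])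
      ultimately show ?thesis
        using backtrack_iff[OF wT _ inT] inT by (auto simp: us legal_move_T)
    qed
    ultimately show ?thesis by simp
  qed
  show ?thesis
  proof (rule winning_strategyI)
    fix w
    assume w: "consistent G S Player2 \<sigma> w" and "game_over G S w"
    then have "even (length w)" using odd_turn[OF w] by (auto simp: game_over_def)
    then show "winner REL G w = Player2" by (simp add: to_move_def)
  next
    fix w
    assume "consistent G S Player2 \<sigma> w" and "to_move w = Player2"
    then show "legal_move G S w (\<sigma> w)"
      using odd_turn by (auto simp: to_move_def split: if_splits)
  qed
qed

section \<open>The game \<open>RAV\<close>\<close>

lemma fresh_move_exists:
  assumes "T \<noteq> {}" and wT: "set w \<subseteq> T" and even: "even (length w)"
    and norep: "\<And>k. k \<le> length w \<Longrightarrow> \<not> repeats G (take k w)"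
  shows "\<exists>s. legal_move G S w s \<and> \<not> repeats G (w @ [s])"
proof -
  let ?v = "\<lambda>k. word_value G (take k w)"
  obtain m where m: "length w = 2 * m" using even by (rule evenE)
  have inj: "inj_on ?v {..length w}" using norep by (rule inj_on_word_value_prefixes)
  \<comment> \<open>The even times up to \<open>2 * m\<close> give \<open>m + 1\<close> distinct
    vertices outside \<open>T\<close>; as the sides have equal size,
    \<open>m < card T\<close>.\<close>
  have "inj_on (\<lambda>i. ?v (2 * i)) {..m}"
    by (intro inj_onI) (use inj_onD[OF inj] in \<open>fastforce simp: m\<close>)
  moreover have "(\<lambda>i. ?v (2 * i)) ` {..m} \<subseteq> carrier G - T"
    using prefix_value_in_T[OF wT] prefix_value_closed[OF wT] by (auto simp: m)
  ultimately have "card {..m} \<le> card (carrier G - T)"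
    using finite_carrier by (intro card_inj_on_le) auto
  then have "m < card T" using assms(1) card_complement_T by auto
  \<comment> \<open>The odd times account for at most \<open>m\<close> vertices of \<open>T\<close>,
    too few to exhaust it.\<close>
  moreover have "card ((\<lambda>i. ?v (2 * i + 1)) ` {..<m}) \<le> m"
    using card_image_le[of "{..<m}"] by simp
  ultimately have "\<not> T \<subseteq> (\<lambda>i. ?v (2 * i + 1)) ` {..<m}"
    by (meson card_mono finite_imageI finite_lessThan le_trans not_less)
  then obtain y where y: "y \<in> T" "y \<notin> (\<lambda>i. ?v (2 * i + 1)) ` {..<m}" by blast
  have fresh: "?v k \<noteq> y" if "k \<le> length w" for k
  proof
    assume "?v k = y"
    then have "odd k" using prefix_value_in_T[OF wT that] y(1) by simp
    then obtain i where "k = 2 * i + 1" by (rule oddE)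
    with y(2) \<open>?v k = y\<close> that m show False by auto
  qed
  have w_notin: "word_value G w \<in> carrier G" "word_value G w \<notin> T"
    using word_value_in_T[OF wT] word_value_closed[OF wT] even by auto
  define s where "s = inv (word_value G w) \<otimes> y"
  have yc: "y \<in> carrier G" using y(1) T_closed by auto
  have sT: "s \<in> T" using inv_mult_in_T w_notin y(1) yc by (simp add: s_def)
  have ws: "word_value G (w @ [s]) = y"
    using w_notin yc by (simp add: s_def m_assoc[symmetric])
  have "\<not> repeats G (w @ [s])"
    using fresh ws by (fastforce simp: repeats_def less_Suc_eq_le)
  \<comment> \<open>The target \<open>y\<close> is unvisited, so in particular it is not the
    previous vertex.\<close>
  moreover have "legal_move G S w s"
    using backtrack_iff[OF wT _ sT] ws fresh[of "length w - 1"] sT by (auto simp: legal_move_T)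
  ultimately show ?thesis by blast
qed

theorem RAV_Player1:
  assumes "T \<noteq> {}"
  shows "has_winning_strategy RAV G S Player1"
proof -
  define \<sigma> where "\<sigma> w = (SOME s. legal_move G S w s \<and> \<not> repeats G (w @ [s]))" for w
  have fresh: "legal_move G S w (\<sigma> w) \<and> \<not> repeats G (w @ [\<sigma> w])"
    if w: "consistent G S Player1 \<sigma> w" and "even (length w)" and "\<not> repeats G w" for w
  proof -
    have "\<not> repeats G (take k w)" if "k \<le> length w" for k
      using consistent_prefix[OF w, of k] \<open>\<not> repeats G w\<close> that
      by (cases "k = length w") (auto simp: game_over_def)
    then have "\<exists>s. legal_move G S w s \<and> \<not> repeats G (w @ [s])"
      using fresh_move_exists[OF assms consistent_in_T[OF w] \<open>even (length w)\<close>] by blast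
    then show ?thesis unfolding \<sigma>_def by (rule someI_ex)
  qed
  show ?thesis
  proof (rule winning_strategyI)
    fix w
    assume w: "consistent G S Player1 \<sigma> w" and over: "game_over G S w"
    show "winner RAV G w = Player1"
    proof (cases "repeats G w")
      case True
      \<comment> \<open>A repetition at odd length would be Player 1's own move, which
        \<open>\<sigma>\<close> avoids.\<close>
      have "even (length w)"
      proof (rule ccontr)
        assume odd: "odd (length w)"
        then obtain u s where us: "w = u @ [s]" by (cases w rule: rev_cases) auto
        have "consistent G S Player1 \<sigma> u" "\<not> repeats G u" "even (length u)" "s = \<sigma> u"
          using consistent_prefix[OF w, of "length u"] odd
          by (auto simp: us game_over_def to_move_def)
        with fresh[of u] True show False by (simp add: us)
      qed
      with True show ?thesis by (simp add: to_move_def)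
    next
      case False
      \<comment> \<open>Without a repetition, the game is over only for lack of a legal move; at
        even length \<open>\<sigma>\<close> supplies one.\<close>
      with over fresh[OF w] have "odd (length w)" by (auto simp: game_over_def)
      with False show ?thesis by (simp add: to_move_def)
    qed
  next
    fix w
    assume "consistent G S Player1 \<sigma> w" and "\<not> game_over G S w" and "to_move w = Player1"
    then show "legal_move G S w (\<sigma> w)"
      using fresh by (auto simp: game_over_def to_move_def split: if_splits)
  qed
qed

end

section \<open>From the Cayley graph to the group\<close>

lemma (in group) cayley_graph_arc_iff:
  assumes "S \<subseteq> carrier G" and "g \<in> carrier G" and "h \<in> carrier G"
  shows "(g, h) \<in> parcs (cayley_graph G S) \<longleftrightarrow> inv g \<otimes> h \<in> S \<union> set_inv S"
proof -
  \<comment> \<open>The first disjunct of the arc relation makes \<open>inv g \<otimes> h\<close> a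
    generator, the second makes it the inverse of one.\<close>
  have "h = g \<otimes> s \<longleftrightarrow> inv g \<otimes> h = s" if "s \<in> S" for s
    using assms that inv_solve_left'[of s g h] by blast
  moreover have "g = h \<otimes> s \<longleftrightarrow> inv g \<otimes> h = inv s" if "s \<in> S" for s
  proof -
    have s: "s \<in> carrier G" using assms(1) that by blast
    have "inv g \<otimes> h = inv s \<longleftrightarrow> inv (inv g \<otimes> h) = s"
      using s assms by (metis inv_inv inv_closed m_closed)
    also have "\<dots> \<longleftrightarrow> inv h \<otimes> g = s"
      using assms by (simp add: inv_mult_group)
    also have "\<dots> \<longleftrightarrow> g = h \<otimes> s"
      using s assms by (metis inv_solve_left)
    finally show ?thesis by blast
  qed
  ultimately show ?thesis
    using assms by (auto simp: cayley_graph_def SET_INV_def)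
qed

lemma bipartite_cayleyI:
  fixes G (structure)
  assumes "group G" and "finite (carrier G)" and "S \<subseteq> carrier G"
    and "complete_bipartite_digraph m k (with_proj (cayley_graph G S))"
  shows "bipartite_cayley G S"
proof -
  interpret group G by fact
  let ?T = "S \<union> set_inv S"
  obtain U V where "carrier G = U \<union> V" "U \<inter> V = {}"
      and "parcs (cayley_graph G S) = U \<times> V \<union> V \<times> U"
    using assms(4) unfolding complete_bipartite_digraph_pair_def
    by (auto simp: cayley_graph_def)
  \<comment> \<open>By symmetry of \<open>U\<close> and \<open>V\<close>, \<open>A\<close> can be
    the side containing \<open>\<one>\<close>. The neighbours of \<open>\<one>\<close> then form
    \<open>B\<close>, which identifies \<open>B\<close> with \<open>?T\<close>.\<close>
  then obtain A B where AB: "carrier G = A \<union> B" "A \<inter> B = {}" "\<one> \<in> A"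
      and arcs: "parcs (cayley_graph G S) = A \<times> B \<union> B \<times> A"
    using one_closed by (metis Un_iff Un_commute Int_commute)
  have B_eq: "h \<in> ?T \<longleftrightarrow> h \<in> B" if "h \<in> carrier G" for h
    using cayley_graph_arc_iff[OF assms(3) one_closed that] AB arcs that by auto
  show ?thesis
  proof
    fix g h assume gh: "g \<in> carrier G" "h \<in> carrier G"
    have "inv g \<otimes> h \<in> ?T \<longleftrightarrow> (g \<in> B \<longleftrightarrow> h \<notin> B)"
      unfolding cayley_graph_arc_iff[OF assms(3) gh, symmetric] arcs
      using AB gh by auto
    then show "inv g \<otimes> h \<in> ?T \<longleftrightarrow> (g \<in> ?T \<longleftrightarrow> h \<notin> ?T)"
      using B_eq gh by simp
  qed (use assms in auto)
qed

theorem theorem2p5: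
  fixes G :: "('a, 'b) monoid_scheme" and S :: "'a set" and n :: nat
  assumes "group G" and "finite (carrier G)" and "order G = 2 * n" and "n \<ge> 2"
    and "S \<subseteq> carrier G" and "generate G S = carrier G" and "\<one>\<^bsub>G\<^esub> \<notin> S"
    and "\<exists>m k. complete_bipartite_digraph m k (with_proj (cayley_graph G S))"
  shows "has_winning_strategy REL G S Player2 \<and> has_winning_strategy RAV G S Player1"
proof -
  interpret bipartite_cayley G S
    using assms(8) bipartite_cayleyI[OF assms(1,2,5)] by blast
  \<comment> \<open>Without letters the generated group is trivial, but its order is at least
    four.\<close>
  have T: "T \<noteq> {}"
  proof
    assume "T = {}"
    then have "carrier G = {\<one>\<^bsub>G\<^esub>}"
      using assms(6) generate_empty by (simp add: T_def)
    with assms(3,4) show False by (simp add: order_def)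
  qed
  have "card (carrier G) = card T + card (carrier G - T)"
    using finite_carrier T_closed by (metis card_Diff_subset card_mono finite_T le_add_diff_inverse)
  \<comment> \<open>The two sides share the \<open>2 * n\<close> elements equally;
    \<open>n \<ge> 2\<close> then gives the bound required by \<open>REL_Player2\<close>.\<close>
  then have "card T = n"
    using T card_complement_T assms(3) by (auto simp: order_def)
  then show ?thesis
    using REL_Player2 RAV_Player1 T assms(4) by simp
qed

end
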